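(* Let $q$ be a power of a prime $p$, let $n\ge1$, and let $m, n_1,\dots,n_m$ be positive integers such that $n_1+\cdots+n_m\ge (q-1)n$. Let $A_1,\dots,A_m\subseteq \mathbb{F}_q^n$ be sets such that for each $1\le i\le m$, $A_i$ does not lie in the zero set of any nonzero polynomial in $\mathbb{F}_q[X_1,\dots,X_n]$ of degree $\le n_i$. Suppose there exist $\alpha^{(1)},\dots,\alpha^{(m)}\in\mathbb{N}^n$ such that $|\alpha^{(i)}|\le n_i$ for each $i$, $\sum_{i=1}^m\alpha^{(i)}=(q-1,\dots,q-1)$, and \[ \binom{(q-1,\dots,q-1)}{\alpha^{(1)},\dots,\alpha^{(m)}}:=\frac{((q-1)!)^n}{\prod_{i=1}^m \alpha^{(i)}!}\not\equiv 0 \pmod p. \] Then $A_1+\cdots+A_m=\mathbb{F}_q^n$.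
   Context: $\mathbb{N}$ denotes the nonnegative integers. For $\alpha=(\alpha_1,\dots,\alpha_n)\in\mathbb{N}^n$, $|\alpha|=\alpha_1+\cdots+\alpha_n$ and $\alpha!=\prod_{j=1}^n\alpha_j!$. For sets $A_1,\dots,A_m$ in an abelian group, $A_1+\cdots+A_m=\{a_1+\cdots+a_m : a_i\in A_i\}$. *)

theory Defs
  imports "HOL-Library.Poly_Mapping" "HOL-Analysis.Finite_Cartesian_Product"
    "HOL-Number_Theory.Cong" "HOL-Computational_Algebra.Primes"
begin

text \<open>
  Formal polynomials over \<open>'a\<close> in the variables \<open>X j\<close>, \<open>j :: 'n\<close>: finitely supported
  coefficient functions on exponent vectors.  A nonzero element of this type is a nonzero formal
  polynomial; as a function on a finite field it may vanish everywhere.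
\<close>
type_synonym ('n, 'a) mvpoly = "('n \<Rightarrow>\<^sub>0 nat) \<Rightarrow>\<^sub>0 'a"

text \<open>The total degree, with the convention that the zero polynomial has degree \<open>0\<close>.\<close>
definition total_degree :: "('n::finite, 'a::zero) mvpoly \<Rightarrow> nat" where
  "total_degree P =
    Max (insert 0 ((\<lambda>\<mu>. \<Sum>j\<in>UNIV. Poly_Mapping.lookup \<mu> j) ` Poly_Mapping.keys P))"

definition mvpoly_eval :: "('n::finite, 'a::comm_semiring_1) mvpoly \<Rightarrow> 'a ^ 'n \<Rightarrow> 'a" where
  "mvpoly_eval P x =
    (\<Sum>\<mu>\<in>Poly_Mapping.keys P. Poly_Mapping.lookup P \<mu> * (\<Prod>j\<in>UNIV. x $ j ^ Poly_Mapping.lookup \<mu> j))"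

definition zero_set :: "('n::finite, 'a::comm_semiring_1) mvpoly \<Rightarrow> ('a ^ 'n) set" where
  "zero_set P = {x. mvpoly_eval P x = 0}"

definition mi_abs :: "nat ^ 'n::finite \<Rightarrow> nat" where
  "mi_abs \<alpha> = (\<Sum>j\<in>UNIV. \<alpha> $ j)"

definition mi_fact :: "nat ^ 'n::finite \<Rightarrow> nat" where
  "mi_fact \<alpha> = (\<Prod>j\<in>UNIV. fact (\<alpha> $ j))"

definition sumset :: "'i set \<Rightarrow> ('i \<Rightarrow> 'b::comm_monoid_add set) \<Rightarrow> 'b set" where
  "sumset I A = {(\<Sum>i\<in>I. a i) | a. \<forall>i\<in>I. a i \<in> A i}"

text \<open>
  If the \<open>\<alpha> i\<close> sum to \<open>\<gamma>\<close>, the quotient is exact, so the truncating division on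
  \<open>nat\<close> computes its true value.
\<close>
definition mi_multinomial :: "nat ^ 'n::finite \<Rightarrow> 'i set \<Rightarrow> ('i \<Rightarrow> nat ^ 'n) \<Rightarrow> nat" where
  "mi_multinomial \<gamma> I \<alpha> = mi_fact \<gamma> div (\<Prod>i\<in>I. mi_fact (\<alpha> i))"

lemma prod_fact_dvd_fact_sum:
  fixes f :: "'i \<Rightarrow> nat"
  shows "(\<Prod>i\<in>I. fact (f i) :: nat) dvd fact (\<Sum>i\<in>I. f i)"
proof (induction I rule: infinite_finite_induct)
  case (insert x F)
  have "(\<Prod>i\<in>insert x F. fact (f i) :: nat) = fact (f x) * (\<Prod>i\<in>F. fact (f i))"
    using insert by simp
  also have "\<dots> dvd fact (f x) * fact (\<Sum>i\<in>F. f i)"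
    using insert.IH by (intro mult_dvd_mono) auto
  also have "\<dots> dvd fact (f x + (\<Sum>i\<in>F. f i))"
    by (rule fact_fact_dvd_fact)
  finally show ?case using insert by simp
qed auto

lemma prod_mi_fact_dvd:
  "(\<Prod>i\<in>I. mi_fact (\<alpha> i)) dvd mi_fact (\<Sum>i\<in>I. \<alpha> i)"
  unfolding mi_fact_def
  by (subst prod.swap) (auto intro!: prod_dvd_prod prod_fact_dvd_fact_sum simp: sum_component)

lemma mi_multinomial_exact:
  assumes "(\<Sum>i\<in>I. \<alpha> i) = \<gamma>"
  shows "mi_multinomial \<gamma> I \<alpha> * (\<Prod>i\<in>I. mi_fact (\<alpha> i)) = mi_fact \<gamma>"
  using prod_mi_fact_dvd[of \<alpha> I] assms by (simp add: mi_multinomial_def)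

lemma mi_multinomial_const:
  "mi_multinomial (\<chi> j::'n::finite. k) I \<alpha> = fact k ^ CARD('n) div (\<Prod>i\<in>I. mi_fact (\<alpha> i))"
  by (simp add: mi_multinomial_def mi_fact_def)

end

theory Submission
  imports Defs "HOL-Number_Theory.Residues"
begin

text \<open>
  Replace \<open>n\<^sub>i\<close> by \<open>|\<alpha>\<^sup>(\<^sup>i\<^sup>)|\<close>.  Since no nonzero polynomial of degree at most
  \<open>|\<alpha>\<^sup>(\<^sup>i\<^sup>)|\<close> vanishes on \<open>A\<^sub>i\<close>, the functional extracting the coefficient of
  \<open>X\<^bsup>\<alpha>\<^sup>(\<^sup>i\<^sup>)\<^esup>\<close> on such polynomials is a weighted sum of evaluations at points of \<open>A\<^sub>i\<close>.
  The convolution \<open>W\<close> of these weights lives on the sumset.  By the binomial theorem its moments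
  of degree at most \<open>(q-1)n\<close> vanish, except that of \<open>X\<^bsup>(q-1,\<dots>,q-1)\<^esup>\<close>, which is the
  multinomial coefficient.  Integrating the indicator \<open>\<Prod>\<^sub>j (1 - (X\<^sub>j - z\<^sub>j)\<^bsup>q-1\<^esup>)\<close> of a
  point \<open>z\<close>, whose top coefficient is \<open>(-1)\<^sup>n\<close>, against \<open>W\<close> gives \<open>W z \<noteq> 0\<close>.
\<close>

section \<open>Monomials and multi-index arithmetic\<close>

text \<open>Exponents are vectors here, unlike in \<open>mvpoly\<close>, so that they share a type
  with the \<open>\<alpha> i\<close> and can be added and subtracted componentwise.\<close>

definition monomial_eval :: "nat ^ 'n::finite \<Rightarrow> 'a::comm_semiring_1 ^ 'n \<Rightarrow> 'a" where
  "monomial_eval \<beta> x = (\<Prod>j\<in>UNIV. x $ j ^ (\<beta> $ j))"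

lemma finite_vec_components:
  fixes S :: "'n::finite \<Rightarrow> 'b set"
  assumes "\<And>j. finite (S j)"
  shows "finite {\<beta>. \<forall>j. \<beta> $ j \<in> S j}"
proof -
  have "finite (PiE UNIV S)"
    using assms by (intro finite_PiE) auto
  moreover have "{\<beta>. \<forall>j. \<beta> $ j \<in> S j} = vec_lambda ` PiE UNIV S"
    by (force simp: image_iff PiE_def Pi_def intro: vec_nth_inverse[symmetric])
  ultimately show ?thesis by simp
qed

lemma prod_sum_vec:
  fixes f :: "'n::finite \<Rightarrow> 'b \<Rightarrow> 'c::comm_semiring_1"
  assumes "\<And>j. finite (S j)"
  shows "(\<Prod>j\<in>UNIV. \<Sum>k\<in>S j. f j k) = (\<Sum>\<beta>\<in>{\<beta>. \<forall>j. \<beta> $ j \<in> S j}. \<Prod>j\<in>UNIV. f j (\<beta> $ j))"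
proof -
  have "(\<Prod>j\<in>UNIV. \<Sum>k\<in>S j. f j k) = (\<Sum>g\<in>PiE UNIV S. \<Prod>j\<in>UNIV. f j (g j))"
    using assms by (intro prod_sum_PiE) auto
  also have "\<dots> = (\<Sum>\<beta>\<in>{\<beta>. \<forall>j. \<beta> $ j \<in> S j}. \<Prod>j\<in>UNIV. f j (\<beta> $ j))"
    by (rule sum.reindex_bij_witness[of _ "\<lambda>\<beta>. ($) \<beta>" vec_lambda]) auto
  finally show ?thesis .
qed

text \<open>The binomial theorem in each coordinate, multiplied out. On the index set \<beta> \<le>
  \<gamma> holds componentwise, so the truncated difference \<open>\<gamma> - \<beta>\<close> is
  exact.\<close>

lemma monomial_eval_add:
  "monomial_eval \<gamma> (x + y) =
    (\<Sum>\<beta>\<in>{\<beta>. \<forall>j. \<beta> $ j \<in> {..\<gamma> $ j}}.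
      of_nat (\<Prod>j\<in>UNIV. (\<gamma> $ j) choose (\<beta> $ j)) * monomial_eval \<beta> x * monomial_eval (\<gamma> - \<beta>) y)"
proof -
  have "monomial_eval \<gamma> (x + y) = (\<Prod>j\<in>UNIV. \<Sum>k\<in>{..\<gamma> $ j}.
      of_nat ((\<gamma> $ j) choose k) * (x $ j) ^ k * (y $ j) ^ (\<gamma> $ j - k))"
    by (simp add: monomial_eval_def binomial_ring)
  then show ?thesis
    by (simp add: prod_sum_vec prod.distrib monomial_eval_def)
qed

lemma mi_abs_add: "mi_abs (\<alpha> + \<beta>) = mi_abs \<alpha> + mi_abs \<beta>"
  by (simp add: mi_abs_def sum.distrib)

lemma mi_abs_eq_0_iff: "mi_abs \<alpha> = 0 \<longleftrightarrow> \<alpha> = 0"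
  by (simp add: mi_abs_def vec_eq_iff)

lemma mi_fact_pos: "mi_fact \<alpha> > 0"
  by (simp add: mi_fact_def)

lemma prod_choose_mult_mi_fact:
  "(\<Prod>j\<in>UNIV. (\<alpha> + \<beta>) $ j choose (\<alpha> $ j)) * mi_fact \<alpha> * mi_fact \<beta> = mi_fact (\<alpha> + \<beta>)"
proof -
  have "((a + b) choose a) * fact a * fact b = (fact (a + b) :: nat)" for a b
    using binomial_fact_lemma[of a "a + b"] by (simp add: algebra_simps)
  then show ?thesis
    unfolding mi_fact_def prod.distrib[symmetric] by simp
qed

lemma finite_mi_abs_le: "finite {\<beta>. mi_abs \<beta> \<le> d}"
proof (rule finite_subset)
  have "\<beta> $ j \<le> mi_abs \<beta>" for \<beta> :: "nat ^ 'n::finite" and j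
    unfolding mi_abs_def by (rule member_le_sum) auto
  then show "{\<beta>. mi_abs \<beta> \<le> d} \<subseteq> {\<beta>. \<forall>j. \<beta> $ j \<in> {..d}}"
    using order_trans by fastforce
qed (rule finite_vec_components, simp)

section \<open>Duality between polynomials and weights\<close>

text \<open>The bridge from coefficient families to formal polynomials. Distinct exponent vectors
  give distinct keys, so every coefficient can be read off \<open>P\<close>; hence \<open>P\<close>
  is nonzero as soon as one coefficient is, even if its evaluation vanishes everywhere.\<close>

lemma mvpoly_of_coefficients:
  fixes c :: "nat ^ 'n::finite \<Rightarrow> 'a::comm_semiring_1"
  obtains P :: "('n, 'a) mvpoly" where
    "total_degree P \<le> d"
    "\<And>x. mvpoly_eval P x = (\<Sum>\<beta>\<in>{\<beta>. mi_abs \<beta> \<le> d}. c \<beta> * monomial_eval \<beta> x)"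
    "P = 0 \<Longrightarrow> \<forall>\<beta>. mi_abs \<beta> \<le> d \<longrightarrow> c \<beta> = 0"
proof
  define B :: "(nat ^ 'n) set" where "B = {\<beta>. mi_abs \<beta> \<le> d}"
  have B: "finite B" by (simp add: B_def finite_mi_abs_le)
  define e :: "nat ^ 'n \<Rightarrow> 'n \<Rightarrow>\<^sub>0 nat" where "e \<beta> = Abs_poly_mapping (($) \<beta>)" for \<beta>
  define P :: "('n, 'a) mvpoly" where "P = (\<Sum>\<beta>\<in>B. Poly_Mapping.single (e \<beta>) (c \<beta>))"
  have e: "Poly_Mapping.lookup (e \<beta>) = ($) \<beta>" for \<beta>
    by (simp add: e_def)
  have inj: "e \<beta> = e \<beta>' \<longleftrightarrow> \<beta> = \<beta>'" for \<beta> \<beta>'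
    by (metis e vec_nth_inject)
  have coeff: "Poly_Mapping.lookup P (e \<beta>) = c \<beta>" if "\<beta> \<in> B" for \<beta>
    using that B by (simp add: P_def lookup_sum lookup_single when_def inj)
  have keys: "Poly_Mapping.keys P \<subseteq> e ` B"
  proof
    fix \<mu> assume "\<mu> \<in> Poly_Mapping.keys P"
    then have "(\<Sum>\<beta>\<in>B. Poly_Mapping.lookup (Poly_Mapping.single (e \<beta>) (c \<beta>)) \<mu>) \<noteq> 0"
      by (simp add: P_def in_keys_iff lookup_sum)
    then obtain \<beta> where "\<beta> \<in> B" "Poly_Mapping.lookup (Poly_Mapping.single (e \<beta>) (c \<beta>)) \<mu> \<noteq> 0"
      by (meson sum.neutral)
    then show "\<mu> \<in> e ` B"
      by (auto simp: lookup_single when_def split: if_splits)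
  qed
  show "total_degree P \<le> d"
    using keys by (force simp: total_degree_def B_def mi_abs_def e)
  show "mvpoly_eval P x = (\<Sum>\<beta>\<in>{\<beta>. mi_abs \<beta> \<le> d}. c \<beta> * monomial_eval \<beta> x)" for x
  proof -
    have "mvpoly_eval P x = (\<Sum>\<mu>\<in>e ` B. Poly_Mapping.lookup P \<mu> *
        (\<Prod>j\<in>UNIV. x $ j ^ Poly_Mapping.lookup \<mu> j))"
      unfolding mvpoly_eval_def using B keys
      by (intro sum.mono_neutral_left) (auto simp: in_keys_iff)
    also have "\<dots> = (\<Sum>\<beta>\<in>B. c \<beta> * monomial_eval \<beta> x)"
      by (subst sum.reindex) (auto simp: inj_on_def inj coeff e monomial_eval_def)
    finally show ?thesis by (simp add: B_def)
  qed
  show "\<forall>\<beta>. mi_abs \<beta> \<le> d \<longrightarrow> c \<beta> = 0" if "P = 0"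
    using coeff that by (auto simp: B_def)
qed

text \<open>Finite-dimensional duality: a vector outside a span is separated from it by a linear
  functional, here given by a weight on \<open>X\<close>. The induction on \<open>S\<close> is one
  elimination step at a time.\<close>

lemma linear_combination_or_separating_weight:
  fixes f :: "'s \<Rightarrow> 'x \<Rightarrow> 'a::field" and g :: "'x \<Rightarrow> 'a"
  assumes "finite S" and X: "finite X"
  shows "(\<exists>c. \<forall>x\<in>X. g x = (\<Sum>s\<in>S. c s * f s x)) \<or>
    (\<exists>w. (\<forall>s\<in>S. (\<Sum>x\<in>X. w x * f s x) = 0) \<and> (\<Sum>x\<in>X. w x * g x) = 1)"
  using \<open>finite S\<close>
proof (induction S arbitrary: g rule: finite_induct)
  case empty
  show ?case
  proof (cases "\<forall>x\<in>X. g x = 0")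
    case False
    then obtain x0 where x0: "x0 \<in> X" "g x0 \<noteq> 0" by blast
    have "(\<Sum>x\<in>X. (if x = x0 then 1 / g x0 else 0) * g x) = 1"
      using x0 X by (simp add: if_distrib[of "\<lambda>t. t * _"] cong: if_cong)
    then show ?thesis by auto
  qed auto
next
  case (insert s S)
  define dot where "dot w h = (\<Sum>x\<in>X. w x * h x)" for w h :: "'x \<Rightarrow> 'a"
  have dot_diff_left: "dot (\<lambda>x. u x - k * v x) h = dot u h - k * dot v h" for u v h k
    by (simp add: dot_def left_diff_distrib sum_subtractf sum_distrib_left mult.assoc)
  have dot_diff_right: "dot u (\<lambda>x. h x - k * h' x) = dot u h - k * dot u h'" for u h h' k
    by (simp add: dot_def right_diff_distrib sum_subtractf sum_distrib_left mult.left_commute)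
  \<comment> \<open>Either \<open>f s\<close> already lies in the span of the earlier functions, so
    the span does not grow, or some weight \<open>v\<close> isolates \<open>f s\<close> from
    them.\<close>
  from insert.IH[of "f s"] show ?case
  proof
    assume "\<exists>c. \<forall>x\<in>X. f s x = (\<Sum>s\<in>S. c s * f s x)"
    then obtain c where c: "\<And>x. x \<in> X \<Longrightarrow> f s x = (\<Sum>s\<in>S. c s * f s x)" by blast
    from insert.IH[of g] show ?case
    proof
      assume "\<exists>c. \<forall>x\<in>X. g x = (\<Sum>s\<in>S. c s * f s x)"
      then obtain b where b: "\<And>x. x \<in> X \<Longrightarrow> g x = (\<Sum>s\<in>S. b s * f s x)" by blast
      have "g x = (\<Sum>t\<in>insert s S. (b(s := 0)) t * f t x)" if "x \<in> X" for x
        using insert.hyps b[OF that] by (auto intro!: sum.cong)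
      then show ?case by blast
    next
      assume "\<exists>w. (\<forall>s\<in>S. (\<Sum>x\<in>X. w x * f s x) = 0) \<and> (\<Sum>x\<in>X. w x * g x) = 1"
      then obtain w where w: "\<And>t. t \<in> S \<Longrightarrow> (\<Sum>x\<in>X. w x * f t x) = 0" "(\<Sum>x\<in>X. w x * g x) = 1"
        by blast
      have "(\<Sum>x\<in>X. w x * f s x) = (\<Sum>t\<in>S. c t * (\<Sum>x\<in>X. w x * f t x))"
        unfolding sum_distrib_left by (subst sum.swap) (simp add: c sum_distrib_left mult_ac)
      then have "(\<Sum>x\<in>X. w x * f s x) = 0" by (simp add: w)
      with w show ?case by blast
    qed
  next
    assume "\<exists>w. (\<forall>t\<in>S. (\<Sum>x\<in>X. w x * f t x) = 0) \<and> (\<Sum>x\<in>X. w x * f s x) = 1"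
    then obtain v where v: "\<And>t. t \<in> S \<Longrightarrow> dot v (f t) = 0" "dot v (f s) = 1"
      unfolding dot_def by blast
    \<comment> \<open>Subtracting this multiple of \<open>f s\<close> makes \<open>v\<close>
      annihilate \<open>h\<close>; the alternative for \<open>h\<close> and \<open>S\<close> then
      decides the one for \<open>g\<close> and \<open>insert s S\<close>.\<close>
    define h where "h x = g x - dot v g * f s x" for x
    from insert.IH[of h] show ?case
    proof
      assume "\<exists>c. \<forall>x\<in>X. h x = (\<Sum>s\<in>S. c s * f s x)"
      then obtain b where b: "\<And>x. x \<in> X \<Longrightarrow> h x = (\<Sum>s\<in>S. b s * f s x)" by blast
      have "g x = (\<Sum>t\<in>insert s S. (b(s := dot v g)) t * f t x)" if "x \<in> X" for x
      proof -
        have "(\<Sum>t\<in>S. (b(s := dot v g)) t * f t x) = h x"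
          unfolding b[OF that] using insert.hyps by (auto intro!: sum.cong)
        then show ?thesis using insert.hyps by (simp add: h_def)
      qed
      then show ?case by blast
    next
      assume "\<exists>w. (\<forall>s\<in>S. (\<Sum>x\<in>X. w x * f s x) = 0) \<and> (\<Sum>x\<in>X. w x * h x) = 1"
      then obtain w where w: "\<And>t. t \<in> S \<Longrightarrow> dot w (f t) = 0" "dot w h = 1"
        unfolding dot_def by blast
      \<comment> \<open>The correction by \<open>v\<close> kills \<open>f s\<close> and keeps the
        functions of \<open>S\<close> killed, while the value on \<open>g\<close> becomes exactly
        \<open>dot w h\<close>.\<close>
      define w' where "w' x = w x - dot w (f s) * v x" for x
      have "dot w g - dot v g * dot w (f s) = 1"
        using w(2) dot_diff_right[of w g "dot v g" "f s"] by (simp add: h_def[abs_def])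
      then have "dot w' g = 1"
        by (simp add: w'_def[abs_def] dot_diff_left) (simp add: mult.commute)
      moreover have "dot w' (f t) = 0" if "t \<in> insert s S" for t
        using that v w(1) by (auto simp: w'_def[abs_def] dot_diff_left)
      ultimately show ?case unfolding dot_def by blast
    qed
  qed
qed

text \<open>If no such weight existed, duality would make the monomial of exponent \<alpha> agree on
  \<open>A\<close> with a combination of the other monomials of degree at most \<open>d\<close>. The
  difference would be a nonzero polynomial of degree at most \<open>d\<close> vanishing on
  \<open>A\<close>.\<close>

lemma coefficient_extracting_weight:
  fixes A :: "('a::{field,finite} ^ 'n::finite) set"
  assumes A: "\<And>P :: ('n, 'a) mvpoly. P \<noteq> 0 \<Longrightarrow> total_degree P \<le> d \<Longrightarrow> \<not> A \<subseteq> zero_set P"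
    and \<alpha>: "mi_abs \<alpha> \<le> d"
  obtains w where "\<And>x. x \<notin> A \<Longrightarrow> w x = 0"
    "\<And>\<beta>. mi_abs \<beta> \<le> d \<Longrightarrow> (\<Sum>x\<in>UNIV. w x * monomial_eval \<beta> x) = of_bool (\<beta> = \<alpha>)"
proof -
  define B :: "(nat ^ 'n) set" where "B = {\<beta>. mi_abs \<beta> \<le> d}"
  have B: "finite B" "\<alpha> \<in> B" using \<alpha> by (simp_all add: B_def finite_mi_abs_le)
  have "\<nexists>c. \<forall>x\<in>A. monomial_eval \<alpha> x = (\<Sum>\<beta>\<in>B - {\<alpha>}. c \<beta> * monomial_eval \<beta> x)"
  proof
    assume "\<exists>c. \<forall>x\<in>A. monomial_eval \<alpha> x = (\<Sum>\<beta>\<in>B - {\<alpha>}. c \<beta> * monomial_eval \<beta> x)"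
    then obtain c where
      c: "\<And>x. x \<in> A \<Longrightarrow> monomial_eval \<alpha> x = (\<Sum>\<beta>\<in>B - {\<alpha>}. c \<beta> * monomial_eval \<beta> x)" by blast
    \<comment> \<open>The coefficient -1 at \<alpha> encodes the difference of the two sides and
      forces \<open>P \<noteq> 0\<close>.\<close>
    obtain P :: "('n, 'a) mvpoly" where P: "total_degree P \<le> d"
      "\<And>x. mvpoly_eval P x = (\<Sum>\<beta>\<in>B. (c(\<alpha> := -1)) \<beta> * monomial_eval \<beta> x)"
      "P = 0 \<Longrightarrow> \<forall>\<beta>. mi_abs \<beta> \<le> d \<longrightarrow> (c(\<alpha> := -1)) \<beta> = 0"
      unfolding B_def using mvpoly_of_coefficients[of d "c(\<alpha> := -1)"] by blast
    have "P \<noteq> 0" using P(3) \<alpha> by (metis fun_upd_same neg_equal_0_iff_equal zero_neq_one)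
    moreover have "A \<subseteq> zero_set P"
    proof
      fix x assume "x \<in> A"
      have "(\<Sum>\<beta>\<in>B - {\<alpha>}. (c(\<alpha> := -1)) \<beta> * monomial_eval \<beta> x) = monomial_eval \<alpha> x"
        unfolding c[OF \<open>x \<in> A\<close>] by (rule sum.cong) auto
      then show "x \<in> zero_set P"
        using B by (simp add: zero_set_def P(2) sum.remove[of B \<alpha>])
    qed
    ultimately show False using A P(1) by blast
  qed
  then obtain w where w: "\<And>\<beta>. \<beta> \<in> B - {\<alpha>} \<Longrightarrow> (\<Sum>x\<in>A. w x * monomial_eval \<beta> x) = 0"
      "(\<Sum>x\<in>A. w x * monomial_eval \<alpha> x) = 1"
    using linear_combination_or_separating_weight[of "B - {\<alpha>}" A "monomial_eval \<alpha>" monomial_eval] B(1)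
    by auto
  define w' where "w' x = (if x \<in> A then w x else 0)" for x
  have "(\<Sum>x\<in>UNIV. w' x * monomial_eval \<beta> x) = (\<Sum>x\<in>A. w x * monomial_eval \<beta> x)" for \<beta>
    by (rule sum.mono_neutral_cong_right) (auto simp: w'_def)
  with w show thesis
    by (intro that[of w']) (auto simp: w'_def B_def)
qed

section \<open>Convolution of the weights\<close>

text \<open>Convolving adds supports, which keeps \<open>W\<close> on the sumset. The moments of a
  convolution expand binomially into products of moments, and the degree bound leaves at most one
  nonzero product; the binomial factors collected over the induction multiply to the multinomial
  coefficient.\<close>

lemma convolution_weight:
  fixes A :: "'i \<Rightarrow> ('a::{field,finite} ^ 'n::finite) set"
  assumes "finite I"
    and "\<And>i P. i \<in> I \<Longrightarrow> (P :: ('n, 'a) mvpoly) \<noteq> 0 \<Longrightarrow> total_degree P \<le> mi_abs (\<alpha> i) \<Longrightarrow>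
      \<not> A i \<subseteq> zero_set P"
  shows "\<exists>W. (\<forall>x. W x \<noteq> 0 \<longrightarrow> x \<in> sumset I A) \<and>
    (\<forall>\<gamma>. mi_abs \<gamma> \<le> mi_abs (\<Sum>i\<in>I. \<alpha> i) \<longrightarrow>
      (\<Sum>x\<in>UNIV. W x * monomial_eval \<gamma> x) =
        of_bool (\<gamma> = (\<Sum>i\<in>I. \<alpha> i)) * of_nat (mi_multinomial (\<Sum>i\<in>I. \<alpha> i) I \<alpha>))"
  using assms
proof (induction I rule: finite_induct)
  case empty
  \<comment> \<open>The empty sumset is {0}, so the point mass at 0 starts the induction; only
    \<gamma> = 0 has degree at most 0.\<close>
  have "(\<Sum>x\<in>UNIV. of_bool (x = 0) * monomial_eval \<gamma> x) = (1 :: 'a)" if "\<gamma> = 0" for \<gamma> :: "nat ^ 'n"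
    by (simp add: that monomial_eval_def of_bool_def)
  then show ?case
    by (intro exI[of _ "\<lambda>x. of_bool (x = 0)"])
      (auto simp: sumset_def mi_abs_eq_0_iff mi_multinomial_def mi_fact_def mi_abs_def[of 0])
next
  case (insert i I)
  define \<sigma> where "\<sigma> = (\<Sum>i\<in>I. \<alpha> i)"
  define M where "M = mi_multinomial \<sigma> I \<alpha>"
  define binom where "binom \<gamma> \<beta> = (\<Prod>j\<in>UNIV. (\<gamma> $ j) choose (\<beta> $ j))" for \<gamma> \<beta> :: "nat ^ 'n"
  have "\<not> A k \<subseteq> zero_set P"
    if "k \<in> I" "P \<noteq> 0" "total_degree P \<le> mi_abs (\<alpha> k)" for k and P :: "('n, 'a) mvpoly"
    using insert.prems that by blast
  from insert.IH[OF this] obtain W where W: "\<And>x. W x \<noteq> 0 \<Longrightarrow> x \<in> sumset I A"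
    "\<And>\<gamma>. mi_abs \<gamma> \<le> mi_abs \<sigma> \<Longrightarrow>
      (\<Sum>x\<in>UNIV. W x * monomial_eval \<gamma> x) = of_bool (\<gamma> = \<sigma>) * of_nat M"
    unfolding \<sigma>_def M_def by blast
  obtain w where w: "\<And>x. x \<notin> A i \<Longrightarrow> w x = 0"
    "\<And>\<beta>. mi_abs \<beta> \<le> mi_abs (\<alpha> i) \<Longrightarrow> (\<Sum>x\<in>UNIV. w x * monomial_eval \<beta> x) = of_bool (\<beta> = \<alpha> i)"
    using coefficient_extracting_weight[of "mi_abs (\<alpha> i)" "A i" "\<alpha> i"] insert.prems by blast
  define V where "V z = (\<Sum>x\<in>UNIV. w x * W (z - x))" for z
  have V: "(\<Sum>z\<in>UNIV. V z * f z) = (\<Sum>x\<in>UNIV. \<Sum>y\<in>UNIV. w x * W y * f (x + y))" for f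
  proof -
    have "(\<Sum>z\<in>UNIV. V z * f z) = (\<Sum>x\<in>UNIV. \<Sum>z\<in>UNIV. w x * W (z - x) * f z)"
      unfolding V_def sum_distrib_right by (rule sum.swap)
    moreover have "(\<Sum>z\<in>UNIV. w x * W (z - x) * f z) = (\<Sum>y\<in>UNIV. w x * W y * f (x + y))" for x
      by (rule sum.reindex_bij_witness[of _ "\<lambda>y. x + y" "\<lambda>z. z - x"]) auto
    ultimately show ?thesis by simp
  qed
  have sum_insert: "(\<Sum>k\<in>insert i I. \<alpha> k) = \<alpha> i + \<sigma>"
    using insert.hyps by (simp add: \<sigma>_def)
  \<comment> \<open>Both sides are compared after multiplication by the positive product of
    factorials, which avoids reasoning about truncating division.\<close>
  have M_insert: "binom (\<alpha> i + \<sigma>) (\<alpha> i) * M = mi_multinomial (\<alpha> i + \<sigma>) (insert i I) \<alpha>"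
  proof -
    have "binom (\<alpha> i + \<sigma>) (\<alpha> i) * M * (\<Prod>k\<in>insert i I. mi_fact (\<alpha> k)) =
        binom (\<alpha> i + \<sigma>) (\<alpha> i) * mi_fact (\<alpha> i) * (M * (\<Prod>k\<in>I. mi_fact (\<alpha> k)))"
      using insert.hyps by (simp add: mult_ac)
    also have "M * (\<Prod>k\<in>I. mi_fact (\<alpha> k)) = mi_fact \<sigma>"
      unfolding M_def by (rule mi_multinomial_exact) (simp add: \<sigma>_def)
    also have "binom (\<alpha> i + \<sigma>) (\<alpha> i) * mi_fact (\<alpha> i) * mi_fact \<sigma> = mi_fact (\<alpha> i + \<sigma>)"
      unfolding binom_def by (rule prod_choose_mult_mi_fact)
    also have "\<dots> = mi_multinomial (\<alpha> i + \<sigma>) (insert i I) \<alpha> * (\<Prod>k\<in>insert i I. mi_fact (\<alpha> k))"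
      by (rule mi_multinomial_exact[symmetric]) (rule sum_insert)
    finally show ?thesis
      using insert.hyps by (simp add: mi_fact_pos[THEN less_imp_neq, symmetric])
  qed
  have "(\<Sum>z\<in>UNIV. V z * monomial_eval \<gamma> z) =
      of_bool (\<gamma> = \<alpha> i + \<sigma>) * of_nat (mi_multinomial (\<alpha> i + \<sigma>) (insert i I) \<alpha>)"
    if \<gamma>: "mi_abs \<gamma> \<le> mi_abs (\<alpha> i + \<sigma>)" for \<gamma>
  proof -
    define D where "D = {\<beta>. \<forall>j. \<beta> $ j \<in> {..\<gamma> $ j}}"
    have D: "finite D" unfolding D_def by (rule finite_vec_components) simp
    have D_split: "\<beta> + (\<gamma> - \<beta>) = \<gamma>" if "\<beta> \<in> D" for \<beta>
      using that by (simp add: D_def vec_eq_iff)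
    have "(\<Sum>z\<in>UNIV. V z * monomial_eval \<gamma> z) = (\<Sum>x\<in>UNIV. \<Sum>y\<in>UNIV. \<Sum>\<beta>\<in>D.
        of_nat (binom \<gamma> \<beta>) * ((w x * monomial_eval \<beta> x) * (W y * monomial_eval (\<gamma> - \<beta>) y)))"
      unfolding V monomial_eval_add D_def[symmetric] binom_def[symmetric] sum_distrib_left
      by (simp add: mult_ac)
    also have "\<dots> = (\<Sum>\<beta>\<in>D. \<Sum>x\<in>UNIV. \<Sum>y\<in>UNIV.
        of_nat (binom \<gamma> \<beta>) * ((w x * monomial_eval \<beta> x) * (W y * monomial_eval (\<gamma> - \<beta>) y)))"
      by (simp only: sum.swap[where B = D])
    also have "\<dots> = (\<Sum>\<beta>\<in>D. of_nat (binom \<gamma> \<beta>) *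
        ((\<Sum>x\<in>UNIV. w x * monomial_eval \<beta> x) * (\<Sum>y\<in>UNIV. W y * monomial_eval (\<gamma> - \<beta>) y)))"
      unfolding sum_product by (simp only: sum_distrib_left)
    also have "\<dots> = (\<Sum>\<beta>\<in>D. if \<beta> = \<alpha> i then
        of_nat (binom \<gamma> (\<alpha> i)) * (of_bool (\<gamma> = \<alpha> i + \<sigma>) * of_nat M) else 0)"
    proof (rule sum.cong[OF refl])
      fix \<beta> assume \<beta>: "\<beta> \<in> D"
      \<comment> \<open>The two degrees cannot both exceed their bounds. If \<beta> is within its
        bound, its moment vanishes unless \<beta> = \<open>\<alpha> i\<close>, and then \<gamma> -
        \<beta> is within its bound too. If \<beta> exceeds its bound, \<gamma> - \<beta> has degree
        strictly below that of \<sigma>, so its moment vanishes.\<close>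
      have abs: "mi_abs \<beta> + mi_abs (\<gamma> - \<beta>) \<le> mi_abs (\<alpha> i) + mi_abs \<sigma>"
        using \<gamma> by (simp add: D_split[OF \<beta>] flip: mi_abs_add)
      show "of_nat (binom \<gamma> \<beta>) *
          ((\<Sum>x\<in>UNIV. w x * monomial_eval \<beta> x) * (\<Sum>y\<in>UNIV. W y * monomial_eval (\<gamma> - \<beta>) y)) =
          (if \<beta> = \<alpha> i then
            of_nat (binom \<gamma> (\<alpha> i)) * (of_bool (\<gamma> = \<alpha> i + \<sigma>) * of_nat M) else 0)"
      proof (cases "mi_abs \<beta> \<le> mi_abs (\<alpha> i)")
        case True
        show ?thesis
        proof (cases "\<beta> = \<alpha> i")
          case eq: True
          then have "\<gamma> - \<beta> = \<sigma> \<longleftrightarrow> \<gamma> = \<alpha> i + \<sigma>"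
            using D_split[OF \<beta>] by auto
          with eq abs show ?thesis by (simp add: w(2) W(2))
        qed (simp add: True w(2))
      next
        case False
        then have "mi_abs (\<gamma> - \<beta>) < mi_abs \<sigma>" using abs by simp
        then have "(\<Sum>y\<in>UNIV. W y * monomial_eval (\<gamma> - \<beta>) y) = 0"
          by (subst W(2)) auto
        with False show ?thesis by auto
      qed
    qed
    \<comment> \<open>When \<gamma> = \<open>\<alpha> i + \<sigma>\<close>, the exponent
      \<open>\<alpha> i\<close> lies in \<open>D\<close>, so the surviving term does occur.\<close>
    also have "\<dots> = of_bool (\<gamma> = \<alpha> i + \<sigma>) * of_nat (binom \<gamma> (\<alpha> i) * M)"
      using D by (auto simp: D_def)
    also have "\<dots> = of_bool (\<gamma> = \<alpha> i + \<sigma>) *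
        of_nat (mi_multinomial (\<alpha> i + \<sigma>) (insert i I) \<alpha>)"
      by (auto simp: M_insert simp del: of_nat_mult)
    finally show ?thesis .
  qed
  moreover have "z \<in> sumset (insert i I) A" if "V z \<noteq> 0" for z
  proof -
    from that obtain x where "w x * W (z - x) \<noteq> 0"
      unfolding V_def by (meson sum.neutral)
    then have x: "x \<in> A i" "z - x \<in> sumset I A"
      using w(1) W(1) by auto
    then obtain a where a: "z - x = (\<Sum>k\<in>I. a k)" "\<forall>k\<in>I. a k \<in> A k"
      by (auto simp: sumset_def)
    \<comment> \<open>Since \<open>i\<close> is not in \<open>I\<close>, storing the new summand
      \<open>x\<close> at \<open>i\<close> leaves the old sum unchanged.\<close>
    have "(\<Sum>k\<in>I. (a(i := x)) k) = (\<Sum>k\<in>I. a k)"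
      using insert.hyps by (intro sum.cong) auto
    then have "z = (\<Sum>k\<in>insert i I. (a(i := x)) k)"
      using insert.hyps a(1) by (simp add: algebra_simps)
    moreover have "\<forall>k\<in>insert i I. (a(i := x)) k \<in> A k"
      using x a(2) by auto
    ultimately show ?thesis unfolding sumset_def by blast
  qed
  ultimately show ?case unfolding sum_insert by blast
qed

section \<open>Finite fields and indicators of points\<close>

text \<open>Multiplication by \<open>x\<close> permutes the nonzero elements, so their nonzero
  product can be cancelled.\<close>

lemma finite_field_power_card_minus_1:
  fixes x :: "'a::{field,finite}"
  assumes "x \<noteq> 0"
  shows "x ^ (CARD('a) - 1) = 1"
proof -
  have "(\<Prod>y\<in>UNIV - {0}. x * y) = (\<Prod>y\<in>UNIV - {0}. y)"
    using assms by (intro prod.reindex_bij_witness[of _ "\<lambda>y. y / x" "\<lambda>y. x * y"]) auto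
  then have "x ^ (CARD('a) - 1) * (\<Prod>y\<in>UNIV - {0}. y) = (\<Prod>y\<in>UNIV - {0::'a}. y)"
    by (simp add: prod.distrib card_Diff_singleton)
  then show ?thesis by simp
qed

text \<open>The characteristic is a prime dividing the cardinality \<open>p ^ k\<close>, hence
  equals \<open>p\<close>. This carries the condition modulo \<open>p\<close> into the
  field.\<close>

lemma of_nat_eq_0_iff_prime_dvd:
  assumes "prime p" and "CARD('a::{field,finite}) = p ^ k"
  shows "of_nat c = (0 :: 'a) \<longleftrightarrow> p dvd c"
proof -
  have "CHAR('a) dvd p ^ k"
    using CHAR_dvd_CARD[where 'a = 'a] assms(2) by simp
  moreover have "prime CHAR('a)"
    by (intro prime_CHAR_semidom finite_imp_CHAR_pos) simp
  ultimately have "CHAR('a) = p"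
    using assms(1) by (meson prime_dvd_power primes_dvd_imp_eq)
  then show ?thesis by (simp add: of_nat_eq_0_iff_char_dvd)
qed

text \<open>Expands the product of the factors 1 - (X_j - z_j)^(q-1), where q is the cardinality of
  the field. Only the leading coefficient of each factor is exposed, since the lower moments of the
  final weight vanish.\<close>

lemma point_indicator_expansion:
  fixes z :: "'a::{field,finite} ^ 'n::finite"
  obtains b :: "'n \<Rightarrow> nat \<Rightarrow> 'a" where
    "\<And>j. b j (CARD('a) - 1) = -1"
    "\<And>x. of_bool (x = z) = (\<Sum>\<gamma>\<in>{\<gamma>. \<forall>j. \<gamma> $ j \<in> {..CARD('a) - 1}}.
      (\<Prod>j\<in>UNIV. b j (\<gamma> $ j)) * monomial_eval \<gamma> x)"
proof -
  define r where "r = CARD('a) - 1"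
  \<comment> \<open>Positivity of \<open>r\<close> keeps the constant 1 away from the leading
    coefficient and gives 0^r = 0 in the indicator.\<close>
  have "card {0, 1 :: 'a} \<le> CARD('a)" by (rule card_mono) auto
  then have r: "r > 0" by (simp add: r_def)
  \<comment> \<open>The coefficient of X^k in 1 - (X - z_j)^r.\<close>
  define b where "b j k = of_bool (k = 0) - of_nat (r choose k) * (- (z $ j)) ^ (r - k)" for j k
  have "b j (CARD('a) - 1) = -1" for j
    unfolding r_def[symmetric] using r by (simp add: b_def)
  moreover have "of_bool (x = z) = (\<Sum>\<gamma>\<in>{\<gamma>. \<forall>j. \<gamma> $ j \<in> {..CARD('a) - 1}}.
      (\<Prod>j\<in>UNIV. b j (\<gamma> $ j)) * monomial_eval \<gamma> x)" for x
  proof -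
    have coord: "(\<Sum>k\<in>{..r}. b j k * (x $ j) ^ k) = of_bool (x $ j = z $ j)" for j
    proof -
      have "(\<Sum>k\<in>{..r}. b j k * (x $ j) ^ k) =
          (\<Sum>k\<in>{..r}. of_bool (k = 0) * (x $ j) ^ k) -
          (\<Sum>k\<in>{..r}. of_nat (r choose k) * (x $ j) ^ k * (- (z $ j)) ^ (r - k))"
        by (simp only: b_def left_diff_distrib sum_subtractf) (simp add: mult_ac)
      also have "\<dots> = 1 - (x $ j - z $ j) ^ r"
        using binomial_ring[of "x $ j" "- (z $ j)" r] by simp
      also have "\<dots> = of_bool (x $ j = z $ j)"
        using r finite_field_power_card_minus_1[of "x $ j - z $ j"] by (auto simp: r_def)
      finally show ?thesis .
    qed
    have "of_bool (x = z) = (\<Prod>j\<in>UNIV. of_bool (x $ j = z $ j) :: 'a)"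
      by (auto simp: vec_eq_iff)
    also have "\<dots> = (\<Prod>j\<in>UNIV. \<Sum>k\<in>{..r}. b j k * (x $ j) ^ k)"
      by (simp add: coord)
    also have "\<dots> = (\<Sum>\<gamma>\<in>{\<gamma>. \<forall>j. \<gamma> $ j \<in> {..r}}. (\<Prod>j\<in>UNIV. b j (\<gamma> $ j)) * monomial_eval \<gamma> x)"
      by (subst prod_sum_vec) (simp_all add: prod.distrib monomial_eval_def)
    finally show ?thesis by (simp add: r_def)
  qed
  ultimately show thesis by (rule that)
qed

section \<open>Positivity of the support at every point\<close>

theorem theorem1p6:
  fixes p q m :: nat
    and ns :: "nat \<Rightarrow> nat"
    and A :: "nat \<Rightarrow> ('a::{field,finite} ^ 'n::finite) set"
  assumes "prime p" and "\<exists>k. q = p ^ k" and "CARD('a) = q"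
    and "m \<ge> 1" and "\<forall>i\<in>{1..m}. ns i \<ge> 1"
    and "(\<Sum>i=1..m. ns i) \<ge> (q - 1) * CARD('n)"
    and "\<forall>i\<in>{1..m}. \<not> (\<exists>P :: ('n, 'a) mvpoly.
           P \<noteq> 0 \<and> total_degree P \<le> ns i \<and> A i \<subseteq> zero_set P)"
    and "\<exists>\<alpha> :: nat \<Rightarrow> nat ^ 'n.
           (\<forall>i\<in>{1..m}. mi_abs (\<alpha> i) \<le> ns i) \<and>
           (\<Sum>i=1..m. \<alpha> i) = (\<chi> j. q - 1) \<and>
           \<not> [mi_multinomial (\<chi> j. q - 1) {1..m} \<alpha> = 0] (mod p)"
  shows "sumset {1..m} A = UNIV"
proof -
  obtain k where k: "q = p ^ k" using assms(2) by blast
  obtain \<alpha> :: "nat \<Rightarrow> nat ^ 'n" where \<alpha>: "\<And>i. i \<in> {1..m} \<Longrightarrow> mi_abs (\<alpha> i) \<le> ns i"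
    "(\<Sum>i=1..m. \<alpha> i) = (\<chi> j. q - 1)" "\<not> [mi_multinomial (\<chi> j. q - 1) {1..m} \<alpha> = 0] (mod p)"
    using assms(8) by blast
  define top :: "nat ^ 'n" where "top = (\<chi> j. q - 1)"
  define M where "M = mi_multinomial top {1..m} \<alpha>"
  \<comment> \<open>Lowering the degree bound from \<open>ns i\<close> to
    \<open>mi_abs (\<alpha> i)\<close> makes the bounds add up to exactly the degree of
    \<open>top\<close>.\<close>
  have "\<not> A i \<subseteq> zero_set P"
    if "i \<in> {1..m}" "P \<noteq> 0" "total_degree P \<le> mi_abs (\<alpha> i)" for i and P :: "('n, 'a) mvpoly"
    using assms(7) \<alpha>(1)[OF that(1)] that by (meson order_trans)
  from convolution_weight[of "{1..m}" \<alpha> A, OF _ this]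
  obtain W where W: "\<And>x. W x \<noteq> 0 \<Longrightarrow> x \<in> sumset {1..m} A"
    "\<And>\<gamma>. mi_abs \<gamma> \<le> mi_abs top \<Longrightarrow>
      (\<Sum>x\<in>UNIV. W x * monomial_eval \<gamma> x) = of_bool (\<gamma> = top) * of_nat M"
    unfolding M_def top_def \<alpha>(2) by auto
  have M: "of_nat M \<noteq> (0 :: 'a)"
    using \<alpha>(3) assms(1,3) k
    by (simp add: of_nat_eq_0_iff_prime_dvd cong_0_iff M_def top_def)
  have "z \<in> sumset {1..m} A" for z
  proof -
    define D where "D = {\<gamma> :: nat ^ 'n. \<forall>j. \<gamma> $ j \<in> {..q - 1}}"
    have D: "finite D" "top \<in> D"
      unfolding D_def by (rule finite_vec_components) (simp_all add: top_def)
    obtain b :: "'n \<Rightarrow> nat \<Rightarrow> 'a" where b: "\<And>j. b j (q - 1) = -1"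
      "\<And>x. of_bool (x = z) = (\<Sum>\<gamma>\<in>D. (\<Prod>j\<in>UNIV. b j (\<gamma> $ j)) * monomial_eval \<gamma> x)"
      using point_indicator_expansion[of z] unfolding D_def assms(3) by blast
    \<comment> \<open>The value at \<open>z\<close> is the integral of the indicator of
      \<open>z\<close> against \<open>W\<close>, hence a combination of moments.\<close>
    have "W z = (\<Sum>x\<in>UNIV. W x * of_bool (x = z))"
      by (simp add: of_bool_def if_distrib cong: if_cong)
    also have "\<dots> = (\<Sum>\<gamma>\<in>D. (\<Prod>j\<in>UNIV. b j (\<gamma> $ j)) * (\<Sum>x\<in>UNIV. W x * monomial_eval \<gamma> x))"
      unfolding b(2) sum_distrib_left by (subst sum.swap) (simp add: mult_ac)
    also have "\<dots> = (\<Sum>\<gamma>\<in>D. if \<gamma> = top then (\<Prod>j\<in>UNIV. b j (top $ j)) * of_nat M else 0)"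
    proof (rule sum.cong[OF refl])
      fix \<gamma> assume "\<gamma> \<in> D"
      \<comment> \<open>Every exponent in the box \<open>D\<close> is componentwise at most
        \<open>top\<close>, so all moments that occur are known.\<close>
      then have "mi_abs \<gamma> \<le> mi_abs top"
        unfolding mi_abs_def by (intro sum_mono) (simp add: D_def top_def)
      then show "(\<Prod>j\<in>UNIV. b j (\<gamma> $ j)) * (\<Sum>x\<in>UNIV. W x * monomial_eval \<gamma> x) =
          (if \<gamma> = top then (\<Prod>j\<in>UNIV. b j (top $ j)) * of_nat M else 0)"
        by (simp add: W(2))
    qed
    also have "\<dots> = (-1) ^ CARD('n) * of_nat M"
      using D b(1) by (simp add: top_def)
    \<comment> \<open>A sign times a nonzero scalar is nonzero, so \<open>z\<close> lies in the
      support of \<open>W\<close> and thus in the sumset.\<close>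
    finally show ?thesis using M W(1) by simp
  qed
  then show ?thesis by blast
qed

end
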